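(* Let $\mathbf{k}$ be an algebraically closed field. For all matrices $A,B\in\mathrm{SL}_2(\mathbf{k})$, $$t_{[A,B]}=t_A^2+t_B^2+t_{AB}^2-t_At_Bt_{AB}-2.$$
   Context: For a square matrix $M$, $t_M=\operatorname{tr}(M)$ denotes its trace, and $[A,B]=ABA^{-1}B^{-1}$ is the commutator. *)

theory Defs
  imports "HOL-Analysis.Analysis" "HOL-Computational_Algebra.Polynomial"
begin

definition SL2 :: "('a::field^2^2) set"
  where "SL2 = {A. det A = 1}"

definition commutator :: "'a::field^'n^'n \<Rightarrow> 'a^'n^'n \<Rightarrow> 'a^'n^'n"
  where "commutator A B = A ** B ** matrix_inv A ** matrix_inv B"

end

theory Submission
  imports Defs
begin

text \<open>By Cayley-Hamilton, the inverse of A in SL2 is trace A - A. Substituting this and expanding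
  expresses the trace of the commutator in terms of the traces of ABB, ABA and ABAB, and
  Cayley-Hamilton reduces these again to the traces of A, B and AB.\<close>

lemma matrix_inv_unique:
  fixes A B :: "'a::field^'n^'n"
  assumes "A ** B = mat 1" and "B ** A = mat 1"
  shows "matrix_inv A = B"
proof -
  \<comment> \<open>\<open>matrix_inv\<close> is a Hilbert choice among two-sided inverses; the
    witness \<open>B\<close> makes the choice meaningful.\<close>
  have "A ** matrix_inv A = mat 1 \<and> matrix_inv A ** A = mat 1"
    unfolding matrix_inv_def by (rule someI [of _ B]) (simp add: assms)
  then have "B ** A ** matrix_inv A = B"
    by (simp add: matrix_mul_assoc [symmetric])
  then show ?thesis
    by (simp add: assms(2))
qed

text \<open>For a 2 by 2 matrix, \<open>mat (trace A) - A\<close> is the adjugate, so its product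
  with \<open>A\<close> on either side is \<open>det A\<close> times the identity.\<close>

lemma matrix_inv_SL2:
  assumes "A \<in> SL2"
  shows "matrix_inv A = mat (trace A) - A"
proof (rule matrix_inv_unique)
  have "A$1$1 * A$2$2 - A$1$2 * A$2$1 = 1"
    using assms by (simp add: SL2_def det_2)
  then show "A ** (mat (trace A) - A) = mat 1" "(mat (trace A) - A) ** A = mat 1"
    by (simp_all add: vec_eq_iff forall_2 matrix_matrix_mult_def sum_2 mat_def trace_def
        algebra_simps)
qed

text \<open>Cayley-Hamilton for \<open>B\<close>, multiplied on the left by \<open>A\<close> and
  traced.\<close>

lemma trace_mult_square:
  fixes A B :: "'a::comm_ring_1^2^2"
  shows "trace (A ** B ** B) = trace B * trace (A ** B) - det B * trace A"
  by (simp add: trace_def det_2 matrix_matrix_mult_def sum_2 algebra_simps)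

lemma trace_square:
  fixes A :: "'a::comm_ring_1^2^2"
  shows "trace (A ** A) = (trace A)\<^sup>2 - 2 * det A"
  by (simp add: trace_def det_2 matrix_matrix_mult_def sum_2 power2_eq_square algebra_simps)

text \<open>Expands a trace whose last factor is an inverse in the form given by
  \<open>matrix_inv_SL2\<close>.\<close>

lemma trace_mult_mat_diff:
  fixes M N :: "'a::comm_ring_1^'n^'n"
  shows "trace (M ** (mat x - N)) = x * trace M - trace (M ** N)"
proof -
  have "trace (M ** (mat x - N)) = trace (M ** mat x) - trace (M ** N)"
    by (simp add: trace_def matrix_matrix_mult_def right_diff_distrib sum_subtractf)
  also have "trace (M ** mat x) = x * trace M"
    by (simp add: trace_def matrix_matrix_mult_def mat_def if_distrib
        sum_distrib_left mult.commute cong: if_cong)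
  finally show ?thesis .
qed

theorem lemma6p1:
  fixes A B :: "'k::alg_closed_field^2^2"
  assumes "A \<in> SL2" and "B \<in> SL2"
  shows "trace (commutator A B) =
    (trace A)\<^sup>2 + (trace B)\<^sup>2 + (trace (A ** B))\<^sup>2
      - trace A * trace B * trace (A ** B) - 2"
proof -
  have det: "det A = 1" "det B = 1"
    using assms by (simp_all add: SL2_def)
  let ?P = "A ** B"
  have PB: "trace (?P ** B) = trace B * trace ?P - trace A"
    using trace_mult_square[of A B] det by simp
  \<comment> \<open>Cyclicity makes the two factors \<open>A\<close> adjacent, so that
    \<open>trace_mult_square\<close> applies with the roles exchanged.\<close>
  have "trace (?P ** A) = trace (B ** A ** A)"
    by (metis matrix_mul_assoc trace_mul_sym)
  then have PA: "trace (?P ** A) = trace A * trace ?P - trace B"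
    using trace_mult_square[of B A] det by (simp add: trace_mul_sym[of B A])
  have PP: "trace (?P ** ?P) = (trace ?P)\<^sup>2 - 2"
    using trace_square[of ?P] det by (simp add: det_mul)
  have "trace (commutator A B) = trace (?P ** (mat (trace A) - A) ** (mat (trace B) - B))"
    using assms by (simp add: commutator_def matrix_inv_SL2)
  also have "\<dots> = trace B * trace (?P ** (mat (trace A) - A))
      - trace (?P ** (mat (trace A) - A) ** B)"
    by (rule trace_mult_mat_diff)
  \<comment> \<open>Rotating \<open>B\<close> to the front leaves the inverse of \<open>A\<close> as
    the last factor, ready to be expanded.\<close>
  also have "trace (?P ** (mat (trace A) - A) ** B) = trace (B ** ?P ** (mat (trace A) - A))"
    by (simp only: trace_mul_sym [of _ B] matrix_mul_assoc)
  also have "\<dots> = trace A * trace (B ** ?P) - trace (B ** ?P ** A)"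
    by (rule trace_mult_mat_diff)
  also have "trace (B ** ?P) = trace (?P ** B)"
    by (rule trace_mul_sym)
  \<comment> \<open>The word BABA is a cyclic rotation of ABAB, the square of
    \<open>?P\<close>.\<close>
  also have "trace (B ** ?P ** A) = trace (?P ** ?P)"
    using trace_mul_sym [of "B ** ?P" A] by (simp add: matrix_mul_assoc)
  also have "trace (?P ** (mat (trace A) - A)) = trace A * trace ?P - trace (?P ** A)"
    by (rule trace_mult_mat_diff)
  finally show ?thesis
    by (simp add: PB PA PP power2_eq_square algebra_simps)
qed

end
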